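(* Let $n,d\in\mathbb N=\{1,2,\dots\}$. The convex cone $(\Sigma+C)_{n,2d}$ is proper in $H_{n,2d}$; that is, it is closed, has nonempty interior in $H_{n,2d}$, and satisfies $(\Sigma+C)_{n,2d}\cap -(\Sigma+C)_{n,2d}\subseteq\{0\}$.
   Context: $H_{n,k}$ is the real (finite-dimensional) vector space of forms of degree $k$ in $n$ variables, with its usual topology. $\Sigma_{n,2d}\subseteq H_{n,2d}$ is the set of finite sums of squares of forms in $H_{n,d}$ (SOS forms). For $f=\sum_\alpha f_\alpha x^\alpha\in H_{n,2d}$: $\operatorname{supp}(f)=\{\alpha\in\mathbb N_0^n:f_\alpha\neq0\}$, $\operatorname{New}(f)=\operatorname{conv}(\operatorname{supp}(f))$, $V(f)$ is the vertex set of $\operatorname{New}(f)$, $\mathcal S(f)=\{\alpha\in\operatorname{supp}(f):\alpha\in(2\mathbb N_0)^n,\ f_\alpha>0\}$, $\mathcal I(f)=\operatorname{supp}(f)\setminus\mathcal S(f)$. A form $f\in H_{n,2d}$ is a circuit if $\mathcal S(f)=V(f)$, $V(f)$ is affinely independent (single points and the empty set count as affinely independent), and either $\mathcal I(f)=\emptyset$ or $\mathcal I(f)=\{\beta\}$ with $\beta$ in the relative interior of $\operatorname{New}(f)$. It is a nonnegative circuit if moreover $f\ge0$ on $\mathbb R^n$. $C_{n,2d}$ is the set of all finite sums of nonnegative circuits in $H_{n,2d}$ (SONC forms). $(\Sigma+C)_{n,2d}=\{g+h: g\in\Sigma_{n,2d},\ h\in C_{n,2d}\}$ is the SOS+SONC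 cone. *)

theory Defs
  imports "HOL-Analysis.Analysis" "HOL-Library.Poly_Mapping"
begin

text \<open>
  Real polynomials in \<open>n = CARD('n)\<close> variables are finitely supported coefficient functions on
  the exponents \<open>nat ^ 'n\<close>; the ring operations of \<^theory>\<open>HOL-Library.Poly_Mapping\<close> are
  those of the polynomial ring. That theory has no scalar multiplication, so the vector space
  structure is added here.
\<close>

type_synonym 'n mpoly = "(nat ^ 'n) \<Rightarrow>\<^sub>0 real"

instantiation poly_mapping :: (type, real_vector) real_vector
begin

lift_definition scaleR_poly_mapping :: "real \<Rightarrow> ('a \<Rightarrow>\<^sub>0 'b) \<Rightarrow> 'a \<Rightarrow>\<^sub>0 'b"
  is "\<lambda>r f k. r *\<^sub>R f k"
  by (erule rev_finite_subset) auto

instance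
  by standard (transfer; simp add: fun_eq_iff scaleR_add_right scaleR_add_left)+

end

definition eval_mpoly :: "'n::finite mpoly \<Rightarrow> real ^ 'n \<Rightarrow> real" where
  "eval_mpoly f x =
     (\<Sum>\<alpha>\<in>Poly_Mapping.keys f. Poly_Mapping.lookup f \<alpha> * (\<Prod>i\<in>UNIV. (x $ i) ^ (\<alpha> $ i)))"

definition forms :: "nat \<Rightarrow> 'n::finite mpoly set" where
  "forms k = {f. \<forall>\<alpha>\<in>Poly_Mapping.keys f. (\<Sum>i\<in>UNIV. \<alpha> $ i) = k}"

text \<open>
  The usual topology of the finite-dimensional space \<open>forms k\<close>: the one making the coefficients
  coordinates. Here \<open>euclidean\<close> is the product topology on functions \<open>nat ^ 'n \<Rightarrow> real\<close>; elements
  of \<open>forms k\<close> vanish outside a fixed finite set of exponents.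
\<close>

definition form_topology :: "nat \<Rightarrow> 'n::finite mpoly topology" where
  "form_topology k = pullback_topology (forms k) Poly_Mapping.lookup euclidean"

definition SOS :: "nat \<Rightarrow> 'n::finite mpoly set" where
  "SOS d = {(\<Sum>j<m. (h j)\<^sup>2) | (m::nat) h. \<forall>j<m. h j \<in> forms d}"

definition real_exponent :: "nat ^ 'n \<Rightarrow> real ^ 'n::finite" where
  "real_exponent \<alpha> = (\<chi> i. real (\<alpha> $ i))"

definition New :: "'n::finite mpoly \<Rightarrow> (real ^ 'n) set" where
  "New f = convex hull (real_exponent ` Poly_Mapping.keys f)"

definition vertices :: "'n::finite mpoly \<Rightarrow> (real ^ 'n) set" where
  "vertices f = {v. v extreme_point_of New f}"

definition even_pos_supp :: "'n::finite mpoly \<Rightarrow> (nat ^ 'n) set" where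
  "even_pos_supp f =
     {\<alpha> \<in> Poly_Mapping.keys f. (\<forall>i. even (\<alpha> $ i)) \<and> Poly_Mapping.lookup f \<alpha> > 0}"

definition inner_supp :: "'n::finite mpoly \<Rightarrow> (nat ^ 'n) set" where
  "inner_supp f = Poly_Mapping.keys f - even_pos_supp f"

definition circuit :: "nat \<Rightarrow> 'n::finite mpoly \<Rightarrow> bool" where
  "circuit d f \<longleftrightarrow>
     f \<in> forms (2 * d) \<and>
     real_exponent ` even_pos_supp f = vertices f \<and>
     \<not> affine_dependent (vertices f) \<and>
     (inner_supp f = {} \<or>
      (\<exists>\<beta>. inner_supp f = {\<beta>} \<and> real_exponent \<beta> \<in> rel_interior (New f)))"

definition nonneg_circuit :: "nat \<Rightarrow> 'n::finite mpoly \<Rightarrow> bool" where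
  "nonneg_circuit d f \<longleftrightarrow> circuit d f \<and> (\<forall>x. eval_mpoly f x \<ge> 0)"

definition SONC :: "nat \<Rightarrow> 'n::finite mpoly set" where
  "SONC d = {(\<Sum>j<m. h j) | (m::nat) h. \<forall>j<m. nonneg_circuit d (h j)}"

definition SOS_SONC :: "nat \<Rightarrow> 'n::finite mpoly set" where
  "SOS_SONC d = {g + h | g h. g \<in> SOS d \<and> h \<in> SONC d}"

end

(* Both generating sets consist of nonnegative forms, so pointedness holds because a form
   vanishing on R^n is zero, and an interior point is already found in the SOS cone: every
   monomial of degree 2d is a product of two monomials of degree d, and
   X^2 + Y^2 + e X Y = (X + e/2 Y)^2 + (1 - e^2/4) Y^2 absorbs small perturbations.

   For closedness, Caratheodory's theorem writes all elements of a convergent sequence with a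
   fixed number of generators. Each generator is nonnegative, hence bounded on a finite grid by
   the sum, and interpolation on the grid bounds its coefficients; so a subsequence of each
   summand converges. A limit of squares is a square. A limit of nonnegative circuits with
   constant support is a sum of monomial squares or again a circuit: if the inner
   coefficient survived while a vertex coefficient tended to 0, then the inner exponent would lie
   outside the convex hull of the remaining ones, and the form would take negative values. *)
theory Submission
  imports Defs "HOL-Computational_Algebra.Polynomial"
begin

section \<open>Exponents of a fixed degree and evaluation of forms\<close>

definition mono_eval :: "nat ^ 'n \<Rightarrow> real ^ 'n::finite \<Rightarrow> real" where
  "mono_eval \<alpha> x = (\<Prod>i\<in>UNIV. (x $ i) ^ (\<alpha> $ i))"

definition exps :: "nat \<Rightarrow> (nat ^ 'n::finite) set" where
  "exps k = {\<alpha>. (\<Sum>i\<in>UNIV. \<alpha> $ i) = k}"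

lemma exps_le: "\<alpha> \<in> exps k \<Longrightarrow> \<alpha> $ i \<le> k"
  unfolding exps_def by (auto intro: member_le_sum)

lemma finite_exps [simp]: "finite (exps k :: (nat ^ 'n::finite) set)"
proof (rule finite_subset)
  show "exps k \<subseteq> vec_lambda ` (UNIV \<rightarrow>\<^sub>E {..k} :: ('n \<Rightarrow> nat) set)"
  proof
    fix \<alpha> :: "nat ^ 'n" assume "\<alpha> \<in> exps k"
    then have "vec_nth \<alpha> \<in> UNIV \<rightarrow>\<^sub>E {..k}" by (auto simp: exps_le)
    then show "\<alpha> \<in> vec_lambda ` (UNIV \<rightarrow>\<^sub>E {..k})" by (metis image_eqI vec_nth_inverse)
  qed
qed (auto intro!: finite_imageI finite_PiE)

lemma exps_add: "\<alpha> \<in> exps j \<Longrightarrow> \<beta> \<in> exps k \<Longrightarrow> \<alpha> + \<beta> \<in> exps (j + k)"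
  by (auto simp: exps_def sum.distrib)

lemma forms_eq: "forms k = {f. Poly_Mapping.keys f \<subseteq> exps k}"
  by (auto simp: forms_def exps_def)

lemma forms_lookup_eq_0:
  "f \<in> forms k \<Longrightarrow> \<alpha> \<notin> exps k \<Longrightarrow> Poly_Mapping.lookup f \<alpha> = 0"
  by (auto simp: forms_eq in_keys_iff)

lemma lookup_scaleR [simp]: "Poly_Mapping.lookup (c *\<^sub>R f) \<alpha> = c * Poly_Mapping.lookup f \<alpha>"
  for f :: "'a \<Rightarrow>\<^sub>0 real"
  by transfer simp

lemma forms_zero [simp]: "0 \<in> forms k"
  by (simp add: forms_eq)

lemma forms_add: "f \<in> forms k \<Longrightarrow> g \<in> forms k \<Longrightarrow> f + g \<in> forms k"
  using keys_add[of f g] by (auto simp: forms_eq)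

lemma forms_scaleR: "f \<in> forms k \<Longrightarrow> c *\<^sub>R f \<in> forms k"
  by (auto simp: forms_eq in_keys_iff)

lemma forms_sum: "(\<And>i. i \<in> I \<Longrightarrow> f i \<in> forms k) \<Longrightarrow> sum f I \<in> forms k"
  by (induction I rule: infinite_finite_induct) (auto intro: forms_add)

lemma forms_mult: "f \<in> forms j \<Longrightarrow> g \<in> forms k \<Longrightarrow> f * g \<in> forms (j + k)"
  using keys_mult[of f g] by (fastforce simp: forms_eq dest: exps_add)

lemma forms_square: "f \<in> forms d \<Longrightarrow> f\<^sup>2 \<in> forms (2 * d)"
  using forms_mult[of f d f d] by (simp add: power2_eq_square mult_2)

lemma forms_single: "\<alpha> \<in> exps k \<Longrightarrow> Poly_Mapping.single \<alpha> c \<in> forms k"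
  by (auto simp: forms_eq)

text \<open>Exponents off the support contribute zero terms. Several polynomials can thus be
  evaluated over one common finite index set, and every form of degree \<open>k\<close> over
  \<open>exps k\<close>.\<close>

lemma eval_mpoly_superset:
  assumes "finite A" "Poly_Mapping.keys f \<subseteq> A"
  shows "eval_mpoly f x = (\<Sum>\<alpha>\<in>A. Poly_Mapping.lookup f \<alpha> * mono_eval \<alpha> x)"
  unfolding eval_mpoly_def mono_eval_def
  by (rule sum.mono_neutral_left) (use assms in \<open>auto simp: in_keys_iff\<close>)

lemma eval_forms:
  "f \<in> forms k \<Longrightarrow> eval_mpoly f x = (\<Sum>\<alpha>\<in>exps k. Poly_Mapping.lookup f \<alpha> * mono_eval \<alpha> x)"
  by (rule eval_mpoly_superset) (auto simp: forms_eq)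

lemma eval_add: "eval_mpoly (f + g) x = eval_mpoly f x + eval_mpoly g x"
proof -
  let ?A = "Poly_Mapping.keys f \<union> Poly_Mapping.keys g"
  have "Poly_Mapping.keys (f + g) \<subseteq> ?A" by (rule keys_add)
  then show ?thesis
    by (simp add: eval_mpoly_superset[of ?A] lookup_add distrib_right sum.distrib)
qed

lemma eval_zero [simp]: "eval_mpoly 0 x = 0"
  by (simp add: eval_mpoly_def)

lemma eval_scaleR: "eval_mpoly (c *\<^sub>R f) x = c * eval_mpoly f x"
proof -
  have "Poly_Mapping.keys (c *\<^sub>R f) \<subseteq> Poly_Mapping.keys f" by (auto simp: in_keys_iff)
  then show ?thesis
    by (simp add: eval_mpoly_superset[of "Poly_Mapping.keys f"] sum_distrib_left mult_ac)
qed

lemma eval_sum: "eval_mpoly (sum f I) x = (\<Sum>i\<in>I. eval_mpoly (f i) x)"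
  by (induction I rule: infinite_finite_induct) (auto simp: eval_add)

lemma eval_single: "eval_mpoly (Poly_Mapping.single \<alpha> c) x = c * mono_eval \<alpha> x"
  by (subst eval_mpoly_superset[of "{\<alpha>}"]) auto

lemma eval_uminus: "eval_mpoly (- f) x = - eval_mpoly f x"
  using eval_add[of f "- f" x] by simp

lemma poly_mapping_eq_sum_single:
  assumes "finite A" "Poly_Mapping.keys f \<subseteq> A"
  shows "f = (\<Sum>\<alpha>\<in>A. Poly_Mapping.single \<alpha> (Poly_Mapping.lookup f \<alpha>))"
proof (rule poly_mapping_eqI)
  fix \<beta>
  have "(\<Sum>\<alpha>\<in>A. Poly_Mapping.lookup (Poly_Mapping.single \<alpha> (Poly_Mapping.lookup f \<alpha>)) \<beta>)
      = (\<Sum>\<alpha>\<in>A. if \<alpha> = \<beta> then Poly_Mapping.lookup f \<alpha> else 0)"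
    by (rule sum.cong) (auto simp: lookup_single when_def)
  also have "\<dots> = Poly_Mapping.lookup f \<beta>"
    using assms by (auto simp: in_keys_iff)
  finally show "Poly_Mapping.lookup f \<beta> = Poly_Mapping.lookup
      (\<Sum>\<alpha>\<in>A. Poly_Mapping.single \<alpha> (Poly_Mapping.lookup f \<alpha>)) \<beta>"
    by (simp add: lookup_sum)
qed

lemma mono_eval_add: "mono_eval (\<alpha> + \<beta>) x = mono_eval \<alpha> x * mono_eval \<beta> x"
  by (simp add: mono_eval_def power_add prod.distrib)

text \<open>Both factors are expanded into single monomials, where multiplicativity reduces to the
  addition of exponents in \<open>mono_eval_add\<close>.\<close>

lemma eval_mult: "eval_mpoly (f * g) x = eval_mpoly f x * eval_mpoly g x"
proof -
  let ?s = "\<lambda>f \<alpha>. Poly_Mapping.single \<alpha> (Poly_Mapping.lookup f \<alpha>)"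
  have "f * g = sum (?s f) (Poly_Mapping.keys f) * sum (?s g) (Poly_Mapping.keys g)"
    using poly_mapping_eq_sum_single[of "Poly_Mapping.keys f" f]
      poly_mapping_eq_sum_single[of "Poly_Mapping.keys g" g] by simp
  also have "eval_mpoly \<dots> x = eval_mpoly f x * eval_mpoly g x"
    by (simp add: sum_product eval_sum eval_single mult_single mono_eval_add
        eval_mpoly_superset[of "Poly_Mapping.keys f" f]
        eval_mpoly_superset[of "Poly_Mapping.keys g" g] mult_ac)
  finally show ?thesis .
qed

lemma eval_square: "eval_mpoly (f\<^sup>2) x = (eval_mpoly f x)\<^sup>2"
  by (simp add: power2_eq_square eval_mult)

section \<open>Interpolation on an integer grid\<close>

text \<open>Lagrange interpolation at the nodes 0, ..., \<open>D\<close> reproduces every monomial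
  of degree at most \<open>D\<close>. Comparing coefficients of degree \<open>a\<close> shows that
  \<open>u a p\<close> can be the coefficient of degree \<open>a\<close> in the Lagrange basis
  polynomial \<open>l p\<close> of the node \<open>p\<close>.\<close>

lemma monomial_coefficient_extraction:
  "\<exists>u :: nat \<Rightarrow> nat \<Rightarrow> real. \<forall>a\<le>D. \<forall>b\<le>D. (\<Sum>p\<le>D. u a p * real p ^ b) = (if a = b then 1 else 0)"
proof -
  define l where "l p = (\<Prod>q\<in>{..D} - {p}. Polynomial.smult (1 / (real p - real q)) [:- real q, 1:])" for p
  have deg: "Polynomial.degree (l p) \<le> D" if "p \<le> D" for p
  proof -
    have "Polynomial.degree (l p) \<le> sum (Polynomial.degree \<circ>
        (\<lambda>q. Polynomial.smult (1 / (real p - real q)) [:- real q, 1:])) ({..D} - {p})"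
      unfolding l_def by (rule degree_prod_sum_le) auto
    also have "\<dots> \<le> (\<Sum>q\<in>{..D} - {p}. 1)"
      by (rule sum_mono) auto
    finally show ?thesis using that by simp
  qed
  have val: "poly (l p) (real r) = (if p = r then 1 else 0)" if "p \<le> D" "r \<le> D" for p r
  proof (cases "p = r")
    case True
    then show ?thesis unfolding l_def by (auto simp: poly_prod diff_divide_distrib[symmetric] intro!: prod.neutral)
  next
    case False
    then show ?thesis unfolding l_def poly_prod using that
      by (auto intro!: prod_zero bexI[of _ r])
  qed
  \<comment> \<open>Both sides have degree at most \<open>D\<close> and agree at the
    \<open>D + 1\<close> nodes.\<close>
  have interp: "(\<Sum>p\<le>D. Polynomial.smult (real p ^ b) (l p)) = Polynomial.monom 1 b" if "b \<le> D" for b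
  proof (rule poly_eqI_degree[of "real ` {..D}"])
    fix x :: real assume "x \<in> real ` {..D}"
    then obtain r where r: "r \<le> D" "x = real r" by auto
    have "poly (\<Sum>p\<le>D. Polynomial.smult (real p ^ b) (l p)) x = (\<Sum>p\<le>D. if p = r then real p ^ b else 0)"
      unfolding poly_sum using r by (intro sum.cong) (auto simp: val)
    also have "\<dots> = real r ^ b" using r by simp
    finally show "poly (\<Sum>p\<le>D. Polynomial.smult (real p ^ b) (l p)) x = poly (Polynomial.monom 1 b) x"
      using r by (simp add: poly_monom)
  next
    have c: "card (real ` {..D}) = D + 1" by (simp add: card_image)
    have "Polynomial.degree (\<Sum>p\<le>D. Polynomial.smult (real p ^ b) (l p)) \<le> D"
      using deg by (intro degree_sum_le) (auto intro: order.trans[OF degree_smult_le])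
    then show "card (real ` {..D}) > Polynomial.degree (\<Sum>p\<le>D. Polynomial.smult (real p ^ b) (l p))"
      unfolding c by simp
    show "card (real ` {..D}) > Polynomial.degree (Polynomial.monom 1 b :: real poly)"
      unfolding c using that by (simp add: degree_monom_eq)
  qed
  have "(\<Sum>p\<le>D. Polynomial.coeff (l p) a * real p ^ b) = (if a = b then 1 else 0)"
    if "a \<le> D" "b \<le> D" for a b
    using arg_cong[OF interp[OF that(2)], of "\<lambda>q. Polynomial.coeff q a"]
    by (auto simp: coeff_sum mult_ac)
  then show ?thesis by (intro exI[of _ "\<lambda>a p. Polynomial.coeff (l p) a"]) auto
qed

definition grid_point :: "('n \<Rightarrow> nat) \<Rightarrow> real ^ 'n::finite" where
  "grid_point p = (\<chi> i. real (p i))"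

text \<open>The weights are products of one-variable weights, so sums over the grid factor into
  one-variable sums. The nodes 0, ..., \<open>k\<close> suffice in each variable because no entry of
  an exponent in \<open>exps k\<close> exceeds \<open>k\<close>.\<close>

lemma grid_interpolation:
  "\<exists>w. \<forall>f \<in> forms k. \<forall>\<alpha> \<in> exps k. Poly_Mapping.lookup (f :: 'n::finite mpoly) \<alpha> =
     (\<Sum>p\<in>UNIV \<rightarrow>\<^sub>E {..k}. w \<alpha> p * eval_mpoly f (grid_point p))"
proof -
  obtain u :: "nat \<Rightarrow> nat \<Rightarrow> real"
    where u: "\<And>a b. a \<le> k \<Longrightarrow> b \<le> k \<Longrightarrow> (\<Sum>p\<le>k. u a p * real p ^ b) = (if a = b then 1 else 0)"
    using monomial_coefficient_extraction[of k] by blast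
  define w where "w \<alpha> p = (\<Prod>i\<in>UNIV. u (\<alpha> $ i) (p i))" for \<alpha> :: "nat ^ 'n" and p
  let ?P = "UNIV \<rightarrow>\<^sub>E {..k} :: ('n \<Rightarrow> nat) set"
  have w: "(\<Sum>p\<in>?P. w \<alpha> p * mono_eval \<beta> (grid_point p)) = (if \<alpha> = \<beta> then 1 else 0)"
    if "\<alpha> \<in> exps k" "\<beta> \<in> exps k" for \<alpha> \<beta>
  proof -
    have "(\<Sum>p\<in>?P. w \<alpha> p * mono_eval \<beta> (grid_point p))
        = (\<Sum>p\<in>?P. \<Prod>i\<in>UNIV. u (\<alpha> $ i) (p i) * real (p i) ^ (\<beta> $ i))"
      by (simp add: w_def mono_eval_def grid_point_def prod.distrib)
    also have "\<dots> = (\<Prod>i\<in>UNIV. \<Sum>p\<le>k. u (\<alpha> $ i) p * real p ^ (\<beta> $ i))"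
      by (rule prod_sum_PiE[symmetric]) auto
    also have "\<dots> = (\<Prod>i\<in>UNIV. if \<alpha> $ i = \<beta> $ i then 1 else 0)"
      using that by (intro prod.cong) (auto simp: u exps_le)
    also have "\<dots> = (if \<alpha> = \<beta> then 1 else 0)"
      by (auto simp: vec_eq_iff)
    finally show ?thesis .
  qed
  have "Poly_Mapping.lookup f \<alpha> = (\<Sum>p\<in>?P. w \<alpha> p * eval_mpoly f (grid_point p))"
    if "f \<in> forms k" "\<alpha> \<in> exps k" for f \<alpha>
  proof -
    have "(\<Sum>p\<in>?P. w \<alpha> p * eval_mpoly f (grid_point p))
        = (\<Sum>\<beta>\<in>exps k. Poly_Mapping.lookup f \<beta> * (\<Sum>p\<in>?P. w \<alpha> p * mono_eval \<beta> (grid_point p)))"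
      by (simp add: eval_forms[OF that(1)] sum_distrib_left mult_ac) (rule sum.swap)
    also have "\<dots> = (\<Sum>\<beta>\<in>exps k. if \<alpha> = \<beta> then Poly_Mapping.lookup f \<beta> else 0)"
      using that by (intro sum.cong) (auto simp: w)
    also have "\<dots> = Poly_Mapping.lookup f \<alpha>" using that by simp
    finally show ?thesis by simp
  qed
  then show ?thesis by blast
qed

text \<open>Coefficients are recovered from values, so identities between forms may be checked
  pointwise; in particular a form that vanishes everywhere is zero.\<close>

lemma forms_eqI:
  fixes f g :: "'a::finite mpoly"
  assumes "f \<in> forms k" "g \<in> forms k" "\<And>x. eval_mpoly f x = eval_mpoly g x"
  shows "f = g"
proof (rule poly_mapping_eqI)
  fix \<alpha>
  obtain w where w: "\<forall>f \<in> forms k. \<forall>\<alpha> \<in> exps k. Poly_Mapping.lookup (f :: 'a mpoly) \<alpha> =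
     (\<Sum>p\<in>UNIV \<rightarrow>\<^sub>E {..k}. w \<alpha> p * eval_mpoly f (grid_point p))"
    using grid_interpolation[where 'n = 'a, of k] by blast
  show "Poly_Mapping.lookup f \<alpha> = Poly_Mapping.lookup g \<alpha>"
  proof (cases "\<alpha> \<in> exps k")
    case True
    then show ?thesis using w assms by simp
  qed (use assms in \<open>simp add: forms_lookup_eq_0\<close>)
qed

text \<open>The constant is the sum of the absolute values of all interpolation weights, so it
  depends on the degree and the number of variables only. Bounds on grid values thereby become
  bounds on coefficients, which yield convergent subsequences.\<close>

lemma forms_coefficient_bound:
  "\<exists>C. \<forall>f \<in> forms k. \<forall>B \<alpha>. (\<forall>p\<in>UNIV \<rightarrow>\<^sub>E {..k}. \<bar>eval_mpoly f (grid_point p)\<bar> \<le> B) \<longrightarrow>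
     \<bar>Poly_Mapping.lookup (f :: 'n::finite mpoly) \<alpha>\<bar> \<le> C * B"
proof -
  let ?P = "UNIV \<rightarrow>\<^sub>E {..k} :: ('n \<Rightarrow> nat) set"
  obtain w where w: "\<And>(f::'n mpoly) \<alpha>. f \<in> forms k \<Longrightarrow> \<alpha> \<in> exps k \<Longrightarrow> Poly_Mapping.lookup f \<alpha> =
     (\<Sum>p\<in>?P. w \<alpha> p * eval_mpoly f (grid_point p))"
    using grid_interpolation[where 'n = 'n, of k] by blast
  define C where "C = (\<Sum>\<alpha>\<in>exps k. \<Sum>p\<in>?P. \<bar>w \<alpha> p\<bar>)"
  have "\<bar>Poly_Mapping.lookup f \<alpha>\<bar> \<le> C * B"
    if f: "f \<in> forms k" and B: "\<forall>p\<in>?P. \<bar>eval_mpoly f (grid_point p)\<bar> \<le> B" for f :: "'n mpoly" and B \<alpha>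
  proof -
    \<comment> \<open>The grid is nonempty since it contains the origin, so \<open>B\<close> bounds
      some absolute value and is nonnegative.\<close>
    have "(\<lambda>_. 0) \<in> ?P" by auto
    then have B0: "B \<ge> 0" using B by (metis abs_ge_zero order.trans)
    show ?thesis
    proof (cases "\<alpha> \<in> exps k")
      case True
      have "\<bar>Poly_Mapping.lookup f \<alpha>\<bar> \<le> (\<Sum>p\<in>?P. \<bar>w \<alpha> p * eval_mpoly f (grid_point p)\<bar>)"
        unfolding w[OF f True] by (rule sum_abs)
      also have "\<dots> \<le> (\<Sum>p\<in>?P. \<bar>w \<alpha> p\<bar> * B)"
        using B by (intro sum_mono) (auto simp: abs_mult intro: mult_left_mono)
      also have "\<dots> = (\<Sum>p\<in>?P. \<bar>w \<alpha> p\<bar>) * B"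
        by (simp add: sum_distrib_right)
      also have "\<dots> \<le> C * B"
        unfolding C_def using True B0
        by (intro mult_right_mono member_le_sum) (auto intro: sum_nonneg)
      finally show ?thesis .
    next
      case False
      then show ?thesis using f B0
        by (auto simp: forms_lookup_eq_0 C_def intro!: mult_nonneg_nonneg sum_nonneg)
    qed
  qed
  then show ?thesis by blast
qed


section \<open>Caratheodory's theorem for cones\<close>

text \<open>More than \<open>card E\<close> vectors in the span of \<open>E\<close> satisfy a
  nontrivial linear relation; moving the coefficients along it until one of them reaches zero
  removes an index. The vectors form an indexed family, so repetitions are allowed.\<close>

lemma cone_caratheodory:
  fixes g :: "'i \<Rightarrow> 'a::real_vector"
  assumes "finite I" "finite E" "\<And>i. i \<in> I \<Longrightarrow> g i \<in> span E" "\<And>i. i \<in> I \<Longrightarrow> c i \<ge> 0"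
  shows "\<exists>J t. J \<subseteq> I \<and> card J \<le> card E \<and> (\<forall>j\<in>J. t j \<ge> 0) \<and>
    (\<Sum>i\<in>I. c i *\<^sub>R g i) = (\<Sum>j\<in>J. t j *\<^sub>R g j)"
  using assms
proof (induction "card I" arbitrary: I c rule: less_induct)
  case less
  show ?case
  proof (cases "card I \<le> card E")
    case True
    then show ?thesis using less.prems by blast
  next
    case False
    have "\<exists>a. (\<exists>i\<in>I. a i \<noteq> 0) \<and> (\<Sum>i\<in>I. a i *\<^sub>R g i) = 0"
    proof (cases "inj_on g I")
      case True
      then have "\<not> independent (g ` I)"
        using independent_span_bound[of E "g ` I"] less.prems False by (auto simp: card_image)
      then obtain u where u: "\<exists>v\<in>g ` I. u v \<noteq> 0" "(\<Sum>v\<in>g ` I. u v *\<^sub>R v) = 0"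
        using less.prems(1) by (auto simp: dependent_finite)
      then show ?thesis using True
        by (intro exI[of _ "u \<circ> g"]) (auto simp: sum.reindex)
    next
      case False
      then obtain p q where pq: "p \<in> I" "q \<in> I" "p \<noteq> q" "g p = g q"
        by (auto simp: inj_on_def)
      \<comment> \<open>Equal vectors at two different indices satisfy the relation with
        coefficients 1 and -1.\<close>
      let ?a = "\<lambda>i. (if i = p then 1 else 0) + (if i = q then - 1 else 0 :: real)"
      have "(\<Sum>i\<in>I. ?a i *\<^sub>R g i) =
          (\<Sum>i\<in>I. if i = p then g p else 0) + (\<Sum>i\<in>I. if i = q then - g q else 0)"
        unfolding sum.distrib[symmetric] by (intro sum.cong refl) (use pq(3) in simp)
      also have "\<dots> = 0" using pq less.prems(1) by simp
      finally show ?thesis using pq by (intro exI[of _ ?a]) auto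
    qed
    then obtain a0 i1 where a0: "i1 \<in> I" "a0 i1 \<noteq> 0" "(\<Sum>i\<in>I. a0 i *\<^sub>R g i) = 0" by blast
    \<comment> \<open>The sign is normalised so that the relation has a positive
      coefficient.\<close>
    define a where "a i = sgn (a0 i1) * a0 i" for i
    have "a i1 > 0" using a0(2) by (simp add: a_def sgn_if)
    moreover have "(\<Sum>i\<in>I. a i *\<^sub>R g i) = 0"
      using a0(3) by (simp add: a_def scaleR_scaleR[symmetric] scaleR_sum_right[symmetric]
          del: scaleR_scaleR)
    ultimately have a: "\<exists>i\<in>I. a i > 0" "(\<Sum>i\<in>I. a i *\<^sub>R g i) = 0"
      using a0(1) by auto
    let ?Q = "{i\<in>I. a i > 0}"
    have "finite ?Q" "?Q \<noteq> {}" using a less.prems(1) by auto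
    \<comment> \<open>The minimal ratio \<open>s\<close> is the largest step for which all
      \<open>c i - s * a i\<close> stay nonnegative, and the coefficient at \<open>i0\<close> then
      becomes zero.\<close>
    then obtain i0 where i0: "i0 \<in> ?Q" "\<And>i. i \<in> ?Q \<Longrightarrow> c i0 / a i0 \<le> c i / a i"
      using arg_min_if_finite(1)[of ?Q "\<lambda>i. c i / a i"] arg_min_least[of ?Q _ "\<lambda>i. c i / a i"]
      by blast
    define s where "s = c i0 / a i0"
    define c' where "c' i = c i - s * a i" for i
    have s0: "s \<ge> 0" using i0 less.prems(4) by (auto simp: s_def)
    have c'0: "c' i \<ge> 0" if "i \<in> I" for i
    proof (cases "a i > 0")
      case True
      then have "s \<le> c i / a i" using i0(2)[of i] that by (simp add: s_def)
      then show ?thesis using True by (simp add: c'_def field_simps)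
    next
      case False
      then have "s * a i \<le> 0" using s0 by (simp add: mult_nonneg_nonpos)
      then show ?thesis using less.prems(4)[OF that] by (simp add: c'_def)
    qed
    have "c' i0 = 0" using i0(1) by (simp add: c'_def s_def)
    have "(\<Sum>i\<in>I. c i *\<^sub>R g i) = (\<Sum>i\<in>I. c' i *\<^sub>R g i)"
      using a(2) by (simp add: c'_def scaleR_diff_left sum_subtractf
          scaleR_scaleR[symmetric] scaleR_sum_right[symmetric] del: scaleR_scaleR)
    also have "\<dots> = (\<Sum>i\<in>I - {i0}. c' i *\<^sub>R g i)"
      using i0(1) less.prems(1) \<open>c' i0 = 0\<close> by (simp add: sum.remove[of I i0])
    finally have eq: "(\<Sum>i\<in>I. c i *\<^sub>R g i) = (\<Sum>i\<in>I - {i0}. c' i *\<^sub>R g i)" .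
    have "card (I - {i0}) < card I"
      using i0(1) less.prems(1) by (intro psubset_card_mono) auto
    from less.hyps[OF this, of c'] obtain J t where
      "J \<subseteq> I - {i0}" "card J \<le> card E" "\<forall>j\<in>J. t j \<ge> 0"
      "(\<Sum>i\<in>I - {i0}. c' i *\<^sub>R g i) = (\<Sum>j\<in>J. t j *\<^sub>R g j)"
      using less.prems c'0 by auto
    then show ?thesis using eq by (intro exI[of _ J] exI[of _ t]) auto
  qed
qed

section \<open>The cone as the finite sums of one generating set\<close>

definition finite_sums :: "'a::comm_monoid_add set \<Rightarrow> 'a set" where
  "finite_sums S = {(\<Sum>j<m. h j) | (m::nat) h. \<forall>j<m. h j \<in> S}"

lemma finite_sums_add_one:
  assumes "x \<in> finite_sums S" "y \<in> S"
  shows "x + y \<in> finite_sums S"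
proof -
  obtain m :: nat and h where h: "x = (\<Sum>j<m. h j)" "\<forall>j<m. h j \<in> S"
    using assms(1) by (auto simp: finite_sums_def)
  have "x + y = (\<Sum>j<Suc m. (h(m := y)) j)" by (simp add: h(1))
  moreover have "\<forall>j<Suc m. (h(m := y)) j \<in> S" using h(2) assms(2) by auto
  ultimately show ?thesis unfolding finite_sums_def by blast
qed

lemma finite_sums_zero [simp]: "0 \<in> finite_sums S"
  unfolding finite_sums_def by (intro CollectI exI[of _ 0]) auto

lemma finite_sums_incl: "x \<in> S \<Longrightarrow> x \<in> finite_sums S"
  using finite_sums_add_one[of 0 S x] by simp

lemma finite_sums_induct [consumes 1, case_names zero add]:
  assumes "x \<in> finite_sums S" "P 0" "\<And>x y. P x \<Longrightarrow> y \<in> S \<Longrightarrow> P (x + y)"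
  shows "P x"
proof -
  have "P (\<Sum>j<m. h j)" if "\<forall>j<m. h j \<in> S" for m :: nat and h
    using that by (induction m) (auto intro: assms)
  then show ?thesis using assms(1) by (auto simp: finite_sums_def)
qed

lemma finite_sums_add:
  assumes "x \<in> finite_sums S" "y \<in> finite_sums S"
  shows "x + y \<in> finite_sums S"
  using assms(2)
  by (induction rule: finite_sums_induct)
     (auto simp: assms(1) add.assoc[symmetric] intro: finite_sums_add_one)

lemma finite_sums_sum:
  "(\<And>i. i \<in> I \<Longrightarrow> g i \<in> finite_sums S) \<Longrightarrow> sum g I \<in> finite_sums S"
  by (induction I rule: infinite_finite_induct) (auto intro: finite_sums_add)

lemma finite_sums_mono: "S \<subseteq> T \<Longrightarrow> finite_sums S \<subseteq> finite_sums T"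
  unfolding finite_sums_def by blast

definition generators :: "nat \<Rightarrow> 'n::finite mpoly set" where
  "generators d = {h\<^sup>2 | h. h \<in> forms d} \<union> {q. nonneg_circuit d q}"

lemma SOS_eq: "SOS d = finite_sums {h\<^sup>2 | h. h \<in> forms d}"
proof -
  have "x \<in> SOS d" if x: "x \<in> finite_sums {h\<^sup>2 | h. h \<in> forms d}" for x :: "'a mpoly"
  proof -
    obtain m :: nat and g where g: "x = (\<Sum>j<m. g j)" "\<forall>j<m. \<exists>h. g j = h\<^sup>2 \<and> h \<in> forms d"
      using x by (auto simp: finite_sums_def)
    obtain h where h: "\<forall>j<m. g j = (h j)\<^sup>2 \<and> h j \<in> forms d" using g(2) by metis
    have "x = (\<Sum>j<m. (h j)\<^sup>2)" unfolding g(1) using h by (intro sum.cong) auto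
    then show ?thesis using h unfolding SOS_def by blast
  qed
  moreover have "SOS d \<subseteq> finite_sums {h\<^sup>2 | h. h \<in> forms d}"
    unfolding SOS_def finite_sums_def by blast
  ultimately show ?thesis by blast
qed

lemma SONC_eq: "SONC d = finite_sums {q. nonneg_circuit d q}"
  by (simp add: SONC_def finite_sums_def)

text \<open>Addition is commutative, so each new generator can be merged into the summand of its own
  kind. With a single generating set, one application of Caratheodory's theorem covers squares and
  circuits together.\<close>

lemma SOS_SONC_eq: "SOS_SONC d = (finite_sums (generators d) :: 'n::finite mpoly set)"
proof
  show "SOS_SONC d \<subseteq> (finite_sums (generators d) :: 'n mpoly set)"
    using finite_sums_mono[of "{h\<^sup>2 | h. h \<in> forms d}" "generators d"]
      finite_sums_mono[of "{q. nonneg_circuit d q}" "generators d"]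
    by (auto simp: SOS_SONC_def SOS_eq SONC_eq generators_def intro!: finite_sums_add)
  show "(finite_sums (generators d) :: 'n mpoly set) \<subseteq> SOS_SONC d"
  proof
    fix x :: "'n mpoly" assume "x \<in> finite_sums (generators d)"
    then show "x \<in> SOS_SONC d"
    proof (induction rule: finite_sums_induct)
      case zero
      show ?case unfolding SOS_SONC_def SOS_eq SONC_eq
        by (intro CollectI exI[of _ 0]) auto
    next
      case (add x y)
      then obtain g h where gh: "x = g + h" "g \<in> SOS d" "h \<in> SONC d"
        by (auto simp: SOS_SONC_def)
      from add(2) consider "g + y \<in> SOS d" | "h + y \<in> SONC d"
        using gh by (auto simp: generators_def SOS_eq SONC_eq intro: finite_sums_add_one)
      then show ?case
      proof cases
        case 1
        then show ?thesis using gh unfolding SOS_SONC_def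
          by (intro CollectI exI[of _ "g + y"] exI[of _ h]) (auto simp: ac_simps)
      next
        case 2
        then show ?thesis using gh unfolding SOS_SONC_def
          by (intro CollectI exI[of _ g] exI[of _ "h + y"]) (auto simp: ac_simps)
      qed
    qed
  qed
qed

lemma generators_forms: "g \<in> generators d \<Longrightarrow> g \<in> forms (2 * d)"
  by (auto simp: generators_def forms_square nonneg_circuit_def circuit_def)

lemma generators_nonneg: "g \<in> generators d \<Longrightarrow> eval_mpoly g x \<ge> 0"
  by (auto simp: generators_def eval_square nonneg_circuit_def)

lemma zero_in_generators: "0 \<in> generators d"
  unfolding generators_def by (auto intro!: exI[of _ 0] simp: power2_eq_square)

text \<open>Being a circuit depends only on the support and on which of its exponents are even with
  positive coefficient. This transfers the property to positive multiples and to limits that lose no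
  term.\<close>

lemma circuit_cong:
  assumes "Poly_Mapping.keys f = Poly_Mapping.keys g" "even_pos_supp f = even_pos_supp g"
  shows "circuit d f \<longleftrightarrow> circuit d g"
  using assms by (simp add: circuit_def forms_def vertices_def New_def inner_supp_def)

text \<open>A square absorbs the factor through \<open>sqrt c\<close>, and a circuit keeps its
  support and signs when \<open>c > 0\<close>; the factor 0 gives the square of the zero
  form.\<close>

lemma generators_scaleR:
  assumes "g \<in> generators d" "c \<ge> 0"
  shows "c *\<^sub>R g \<in> generators d"
proof (cases "c = 0")
  case True
  then show ?thesis by (simp add: zero_in_generators)
next
  case False
  then have c: "c > 0" using assms by simp
  from assms(1) consider h where "h \<in> forms d" "g = h\<^sup>2" | "nonneg_circuit d g"
    by (auto simp: generators_def)
  then show ?thesis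
  proof cases
    case 1
    have "c *\<^sub>R g = (sqrt c *\<^sub>R h)\<^sup>2"
      using 1 c by (intro forms_eqI[of _ "2 * d"])
        (auto intro!: forms_scaleR forms_square simp: eval_scaleR eval_square power_mult_distrib)
    then show ?thesis using 1 forms_scaleR[of h d "sqrt c"] unfolding generators_def by blast
  next
    case 2
    have k: "Poly_Mapping.keys (c *\<^sub>R g) = Poly_Mapping.keys g"
      using c by (auto simp: in_keys_iff)
    have "even_pos_supp (c *\<^sub>R g) = even_pos_supp g"
      using c by (auto simp: even_pos_supp_def k zero_less_mult_iff)
    then have "nonneg_circuit d (c *\<^sub>R g)"
      using 2 c circuit_cong[OF k] by (simp add: nonneg_circuit_def eval_scaleR)
    then show ?thesis by (simp add: generators_def)
  qed
qed

section \<open>Nonnegativity, convexity and pointedness\<close>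

lemma SOS_SONC_forms_nonneg:
  assumes "f \<in> SOS_SONC d"
  shows "f \<in> forms (2 * d) \<and> eval_mpoly f x \<ge> 0"
  using assms unfolding SOS_SONC_eq
  by (induction rule: finite_sums_induct)
     (auto simp: eval_add generators_nonneg generators_forms intro: forms_add)

lemma convex_cone_SOS_SONC: "convex_cone (SOS_SONC d)"
proof -
  have "c *\<^sub>R x \<in> finite_sums (generators d)"
    if "x \<in> finite_sums (generators d)" "c \<ge> 0" for c and x :: "'a mpoly"
    using that(1)
    by (induction rule: finite_sums_induct)
       (auto simp: scaleR_add_right intro: finite_sums_add_one generators_scaleR that(2))
  then show ?thesis
    unfolding convex_cone_iff SOS_SONC_eq by (auto intro: finite_sums_add)
qed

lemma SOS_SONC_pointed: "SOS_SONC d \<inter> uminus ` SOS_SONC d \<subseteq> {0}"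
proof
  fix f :: "'a mpoly" assume "f \<in> SOS_SONC d \<inter> uminus ` SOS_SONC d"
  then obtain g where g: "f \<in> SOS_SONC d" "g \<in> SOS_SONC d" "f = - g" by auto
  have "eval_mpoly f x = 0" for x
    using SOS_SONC_forms_nonneg[OF g(1), of x] SOS_SONC_forms_nonneg[OF g(2), of x]
    by (simp add: g(3) eval_uminus)
  then have "f = 0" using SOS_SONC_forms_nonneg[OF g(1)] by (intro forms_eqI[of _ "2 * d"]) auto
  then show "f \<in> {0}" by simp
qed

section \<open>An interior point\<close>

text \<open>The exponent \<open>\<beta>\<close> grows by one unit at a time: while its total is
  below that of \<open>\<alpha>\<close>, some coordinate still has room.\<close>

lemma exponent_split:
  "m \<le> (\<Sum>i\<in>UNIV. \<alpha> $ i) \<Longrightarrow> \<exists>\<beta>. (\<forall>i. \<beta> $ i \<le> \<alpha> $ i) \<and> (\<Sum>i\<in>UNIV. \<beta> $ i) = m"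
  for \<alpha> :: "nat ^ 'n::finite"
proof (induction m)
  case 0
  then show ?case by (intro exI[of _ 0]) auto
next
  case (Suc m)
  then obtain \<beta> where b: "\<forall>i. \<beta> $ i \<le> \<alpha> $ i" "(\<Sum>i\<in>UNIV. \<beta> $ i) = m" by auto
  have "\<exists>i. \<beta> $ i < \<alpha> $ i"
  proof (rule ccontr)
    assume "\<not> ?thesis"
    then have "(\<Sum>i\<in>UNIV. \<alpha> $ i) \<le> (\<Sum>i\<in>UNIV. \<beta> $ i)" by (intro sum_mono) (auto simp: not_less)
    then show False using b(2) Suc.prems by simp
  qed
  then obtain i0 where i0: "\<beta> $ i0 < \<alpha> $ i0" by blast
  let ?b = "\<chi> i. \<beta> $ i + (if i = i0 then 1 else 0)"
  have "(\<Sum>i\<in>UNIV. ?b $ i) = Suc m" using b(2) by (simp add: sum.distrib)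
  moreover have "\<forall>i. ?b $ i \<le> \<alpha> $ i" using b(1) i0 by auto
  ultimately show ?case by blast
qed

lemma exps_split:
  assumes "\<alpha> \<in> exps (2 * d)"
  shows "\<exists>\<beta>\<in>exps d. \<exists>\<gamma>\<in>exps d. \<alpha> = \<beta> + \<gamma>"
proof -
  have "d \<le> (\<Sum>i\<in>UNIV. \<alpha> $ i)" using assms by (simp add: exps_def)
  then obtain \<beta> where b: "\<forall>i. \<beta> $ i \<le> \<alpha> $ i" "(\<Sum>i\<in>UNIV. \<beta> $ i) = d"
    using exponent_split by blast
  have eq: "\<alpha> = \<beta> + (\<chi> i. \<alpha> $ i - \<beta> $ i)" using b(1) by (simp add: vec_eq_iff)
  have "(\<Sum>i\<in>UNIV. \<alpha> $ i - \<beta> $ i) = d"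
    using b assms by (simp add: sum_subtractf_nat exps_def)
  then have "(\<chi> i. \<alpha> $ i - \<beta> $ i) \<in> exps d" by (simp add: exps_def)
  moreover have "\<beta> \<in> exps d" using b(2) by (simp add: exps_def)
  ultimately show ?thesis using eq by blast
qed

lemma interior_SOS_SONC:
  "form_topology (2 * d) interior_of (SOS_SONC d :: 'n::finite mpoly set) \<noteq> {}"
proof -
  obtain b c where bc: "\<And>\<alpha> :: nat ^ 'n. \<alpha> \<in> exps (2 * d) \<Longrightarrow>
      b \<alpha> \<in> exps d \<and> c \<alpha> \<in> exps d \<and> \<alpha> = b \<alpha> + c \<alpha>"
    using exps_split[where 'a = 'n, of _ d] by metis
  let ?X = "\<lambda>\<alpha>. Poly_Mapping.single \<alpha> (1::real)"
  \<comment> \<open>Every monomial of degree \<open>2 * d\<close> contributes the squares of its two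
    chosen halves. These absorb a multiple of that monomial with coefficient up to 2 in absolute
    value; radius 1 is used.\<close>
  define f0 where "f0 = (\<Sum>\<alpha>\<in>exps (2 * d). (?X (b \<alpha>))\<^sup>2 + (?X (c \<alpha>))\<^sup>2)"
  have f0: "f0 \<in> forms (2 * d)"
    unfolding f0_def using bc by (intro forms_sum forms_add forms_square forms_single) auto
  have near: "f \<in> SOS_SONC d"
    if f: "f \<in> forms (2 * d)"
      and close: "\<And>\<alpha>. \<alpha> \<in> exps (2 * d) \<Longrightarrow>
        \<bar>Poly_Mapping.lookup f \<alpha> - Poly_Mapping.lookup f0 \<alpha>\<bar> < 1" for f
  proof -
    define e where "e \<alpha> = Poly_Mapping.lookup f \<alpha> - Poly_Mapping.lookup f0 \<alpha>" for \<alpha>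
    \<comment> \<open>Completing the square: with X and Y the halves of \<alpha>,
      \<open>g \<alpha>\<close> is X + (e/2) Y, and \<open>h \<alpha>\<close> supplies the remaining
      (1 - (e/2)^2) Y^2.\<close>
    define g where "g \<alpha> = (?X (b \<alpha>) + (e \<alpha> / 2) *\<^sub>R ?X (c \<alpha>))" for \<alpha>
    define h where "h \<alpha> = sqrt (1 - (e \<alpha> / 2)\<^sup>2) *\<^sub>R ?X (c \<alpha>)" for \<alpha>
    have gh: "g \<alpha> \<in> forms d" "h \<alpha> \<in> forms d" if "\<alpha> \<in> exps (2 * d)" for \<alpha>
      using bc[OF that] by (auto simp: g_def h_def intro!: forms_add forms_scaleR forms_single)
    have "f = (\<Sum>\<alpha>\<in>exps (2 * d). (g \<alpha>)\<^sup>2 + (h \<alpha>)\<^sup>2)"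
    proof (rule forms_eqI[OF f])
      show "(\<Sum>\<alpha>\<in>exps (2 * d). (g \<alpha>)\<^sup>2 + (h \<alpha>)\<^sup>2) \<in> forms (2 * d)"
        using gh by (intro forms_sum forms_add forms_square) auto
      fix x
      have "(eval_mpoly (g \<alpha>) x)\<^sup>2 + (eval_mpoly (h \<alpha>) x)\<^sup>2 =
          (mono_eval (b \<alpha>) x)\<^sup>2 + (mono_eval (c \<alpha>) x)\<^sup>2 + e \<alpha> * mono_eval \<alpha> x"
        if \<alpha>: "\<alpha> \<in> exps (2 * d)" for \<alpha>
      proof -
        have "(e \<alpha> / 2)\<^sup>2 \<le> 1"
          using close[OF \<alpha>] by (intro abs_square_le_1[THEN iffD2]) (simp add: e_def)
        then have "(eval_mpoly (h \<alpha>) x)\<^sup>2 = (1 - (e \<alpha> / 2)\<^sup>2) * (mono_eval (c \<alpha>) x)\<^sup>2"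
          by (simp add: h_def eval_scaleR eval_single power_mult_distrib)
        moreover have "mono_eval \<alpha> x = mono_eval (b \<alpha>) x * mono_eval (c \<alpha>) x"
          using bc[OF \<alpha>] by (metis mono_eval_add)
        ultimately show ?thesis
          by (simp add: g_def eval_add eval_scaleR eval_single power2_eq_square algebra_simps)
      qed
      then have "eval_mpoly (\<Sum>\<alpha>\<in>exps (2 * d). (g \<alpha>)\<^sup>2 + (h \<alpha>)\<^sup>2) x =
          (\<Sum>\<alpha>\<in>exps (2 * d). (mono_eval (b \<alpha>) x)\<^sup>2 + (mono_eval (c \<alpha>) x)\<^sup>2 + e \<alpha> * mono_eval \<alpha> x)"
        by (simp add: eval_sum eval_add eval_square)
      also have "\<dots> = eval_mpoly f0 x + (eval_mpoly f x - eval_mpoly f0 x)"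
        \<comment> \<open>Expanding in coefficients turns the difference into a sum with
          coefficients \<open>e \<alpha>\<close>. The leading \<open>eval_mpoly f0 x\<close> gets
          expanded as well and is folded back afterwards.\<close>
        unfolding eval_forms[OF f] eval_forms[OF f0] sum_subtractf[symmetric]
          left_diff_distrib[symmetric] e_def[symmetric]
        unfolding eval_forms[OF f0, symmetric]
        by (simp add: f0_def eval_sum eval_add eval_square eval_single sum.distrib)
      finally show "eval_mpoly f x = eval_mpoly (\<Sum>\<alpha>\<in>exps (2 * d). (g \<alpha>)\<^sup>2 + (h \<alpha>)\<^sup>2) x"
        by simp
    qed
    also have "\<dots> \<in> SOS_SONC d"
      unfolding SOS_SONC_eq using gh
      by (intro finite_sums_sum finite_sums_add finite_sums_incl) (auto simp: generators_def)
    finally show ?thesis .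
  qed
  \<comment> \<open>Only finitely many coordinates are restricted, so this set is open in the
    product topology.\<close>
  define U where "U = (\<Inter>\<alpha>\<in>exps (2 * d). {\<phi>. \<bar>\<phi> \<alpha> - Poly_Mapping.lookup f0 \<alpha>\<bar> < (1::real)})"
  have "open U"
    unfolding U_def by (intro open_INT ballI open_Collect_less continuous_intros) auto
  then have "openin (form_topology (2 * d)) (Poly_Mapping.lookup -` U \<inter> forms (2 * d))"
    unfolding form_topology_def openin_pullback_topology by auto
  moreover have "Poly_Mapping.lookup -` U \<inter> forms (2 * d) \<subseteq> SOS_SONC d"
    using near by (auto simp: U_def)
  moreover have "f0 \<in> Poly_Mapping.lookup -` U \<inter> forms (2 * d)"
    using f0 by (auto simp: U_def)
  ultimately show ?thesis unfolding interior_of_def by blast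
qed

section \<open>Coefficientwise limits and convergent subsequences\<close>

text \<open>This is convergence in the product topology from which \<open>form_topology\<close> is
  pulled back.\<close>

definition coeff_lim :: "(nat \<Rightarrow> 'n::finite mpoly) \<Rightarrow> 'n mpoly \<Rightarrow> bool" where
  "coeff_lim F f \<longleftrightarrow> (\<forall>\<alpha>. (\<lambda>k. Poly_Mapping.lookup (F k) \<alpha>) \<longlonglongrightarrow> Poly_Mapping.lookup f \<alpha>)"

lemma coeff_lim_subseq: "coeff_lim F f \<Longrightarrow> strict_mono r \<Longrightarrow> coeff_lim (\<lambda>k. F (r k)) f"
  unfolding coeff_lim_def using LIMSEQ_subseq_LIMSEQ by (fastforce simp: o_def)

lemma coeff_lim_unique: "coeff_lim F f \<Longrightarrow> coeff_lim F g \<Longrightarrow> f = g"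
  unfolding coeff_lim_def by (auto intro!: poly_mapping_eqI intro: LIMSEQ_unique)

lemma coeff_lim_eval:
  assumes "\<And>k. F k \<in> forms m" "f \<in> forms m" "coeff_lim F f"
  shows "(\<lambda>k. eval_mpoly (F k) x) \<longlonglongrightarrow> eval_mpoly f x"
  unfolding eval_forms[OF assms(1)] eval_forms[OF assms(2)]
  using assms(3) by (auto simp: coeff_lim_def intro!: tendsto_intros)

text \<open>Bolzano-Weierstrass is applied once per index, each time thinning out the subsequence
  found before.\<close>

lemma common_convergent_subseq:
  fixes x :: "'i \<Rightarrow> nat \<Rightarrow> real"
  assumes "finite I" "\<And>i k. i \<in> I \<Longrightarrow> \<bar>x i k\<bar> \<le> B"
  shows "\<exists>r. strict_mono r \<and> (\<forall>i\<in>I. convergent (\<lambda>k. x i (r k)))"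
  using assms
proof (induction I rule: finite_induct)
  case empty
  show ?case by (intro exI[of _ id]) (auto simp: strict_mono_def)
next
  case (insert i I)
  then obtain r where r: "strict_mono r" "\<forall>i\<in>I. convergent (\<lambda>k. x i (r k))" by auto
  have "seq_compact {-B..B}" by (simp add: compact_imp_seq_compact)
  moreover have "\<forall>k. x i (r k) \<in> {-B..B}" using insert.prems by (auto simp: abs_le_iff minus_le_iff)
  ultimately obtain l r' where r': "strict_mono r'" "((\<lambda>k. x i (r k)) \<circ> r') \<longlonglongrightarrow> l"
    by (rule seq_compactE) blast
  have "convergent (\<lambda>k. x j (r (r' k)))" if "j \<in> insert i I" for j
  proof (cases "j = i")
    case True
    then show ?thesis using r'(2) by (auto simp: convergent_def o_def)
  next
    case False
    then show ?thesis
      using that r(2) convergent_subseq_convergent[OF _ r'(1), of "\<lambda>k. x j (r k)"]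
      by (auto simp: o_def)
  qed
  then show ?case using strict_mono_o[OF r(1) r'(1)] by (intro exI[of _ "r \<circ> r'"]) (auto simp: o_def)
qed

text \<open>Only the finitely many coefficients at exponents in \<open>exps m\<close> can be
  nonzero, so one subsequence serves all of them and all members of the family; the limit forms are
  assembled from the limits of the coefficients.\<close>

lemma forms_common_subseq:
  fixes G :: "'i \<Rightarrow> nat \<Rightarrow> 'n::finite mpoly"
  assumes "finite I" "\<And>i k. i \<in> I \<Longrightarrow> G i k \<in> forms m"
    and "\<And>i k \<alpha>. i \<in> I \<Longrightarrow> \<bar>Poly_Mapping.lookup (G i k) \<alpha>\<bar> \<le> B"
  shows "\<exists>r h. strict_mono r \<and> (\<forall>i\<in>I. h i \<in> forms m \<and> coeff_lim (\<lambda>k. G i (r k)) (h i))"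
proof -
  have "\<exists>r. strict_mono r \<and>
      (\<forall>p\<in>I \<times> exps m. convergent (\<lambda>k. (\<lambda>p k. Poly_Mapping.lookup (G (fst p) k) (snd p)) p (r k)))"
    by (rule common_convergent_subseq[where B = B]) (use assms in auto)
  then obtain r where r: "strict_mono r"
    "\<And>i \<alpha>. i \<in> I \<Longrightarrow> \<alpha> \<in> exps m \<Longrightarrow> convergent (\<lambda>k. Poly_Mapping.lookup (G i (r k)) \<alpha>)"
    by auto
  define h where "h i = (\<Sum>\<alpha>\<in>exps m.
      Poly_Mapping.single \<alpha> (lim (\<lambda>k. Poly_Mapping.lookup (G i (r k)) \<alpha>)))" for i
  have h: "h i \<in> forms m" for i
    unfolding h_def by (intro forms_sum forms_single)
  have lookup_h: "Poly_Mapping.lookup (h i) \<alpha> = lim (\<lambda>k. Poly_Mapping.lookup (G i (r k)) \<alpha>)"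
    if "\<alpha> \<in> exps m" for i \<alpha>
    using that by (simp add: h_def lookup_sum lookup_single when_def)
  have "coeff_lim (\<lambda>k. G i (r k)) (h i)" if i: "i \<in> I" for i
    unfolding coeff_lim_def
  proof
    fix \<alpha>
    show "(\<lambda>k. Poly_Mapping.lookup (G i (r k)) \<alpha>) \<longlonglongrightarrow> Poly_Mapping.lookup (h i) \<alpha>"
    proof (cases "\<alpha> \<in> exps m")
      case True
      then show ?thesis using r(2)[OF i True] by (simp add: lookup_h convergent_LIMSEQ_iff)
    next
      case False
      then show ?thesis
        using forms_lookup_eq_0[OF h False] forms_lookup_eq_0[OF assms(2)[OF i] False] by simp
    qed
  qed
  then show ?thesis using r(1) h by blast
qed

text \<open>The sum of the absolute values over the grid converges, hence is bounded. The grid size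
  \<open>m'\<close> is separate from the degree \<open>m\<close> because the roots of squares of
  degree \<open>2 * d\<close> are interpolated on the grid for degree \<open>d\<close>.\<close>

lemma coeff_lim_grid_bounded:
  fixes F :: "nat \<Rightarrow> 'n::finite mpoly"
  assumes "\<And>k. F k \<in> forms m" "f \<in> forms m" "coeff_lim F f"
  shows "\<exists>B. \<forall>k. \<forall>p\<in>UNIV \<rightarrow>\<^sub>E {..m'}. \<bar>eval_mpoly (F k) (grid_point p)\<bar> \<le> B"
proof -
  let ?P = "UNIV \<rightarrow>\<^sub>E {..m'} :: ('n \<Rightarrow> nat) set"
  have fin: "finite ?P" by (auto intro: finite_PiE)
  have "(\<lambda>k. \<Sum>p\<in>?P. \<bar>eval_mpoly (F k) (grid_point p)\<bar>) \<longlonglongrightarrow> (\<Sum>p\<in>?P. \<bar>eval_mpoly f (grid_point p)\<bar>)"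
    by (intro tendsto_intros coeff_lim_eval[OF assms])
  then have "Bseq (\<lambda>k. \<Sum>p\<in>?P. \<bar>eval_mpoly (F k) (grid_point p)\<bar>)"
    using convergentI convergent_imp_Bseq by blast
  then obtain B where B: "\<And>k. norm (\<Sum>p\<in>?P. \<bar>eval_mpoly (F k) (grid_point p)\<bar>) \<le> B"
    by (auto simp: Bseq_def)
  have "\<bar>eval_mpoly (F k) (grid_point p)\<bar> \<le> B" if p: "p \<in> ?P" for k p
  proof -
    have "\<bar>eval_mpoly (F k) (grid_point p)\<bar> \<le> (\<Sum>p\<in>?P. \<bar>eval_mpoly (F k) (grid_point p)\<bar>)"
      using fin p by (intro member_le_sum) auto
    also have "\<dots> \<le> B" using B[of k] by (simp add: abs_le_iff)
    finally show ?thesis .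
  qed
  then show ?thesis by blast
qed

section \<open>Limits of squares\<close>

text \<open>On the grid the roots are bounded by \<open>sqrt B\<close>, so their coefficients are
  bounded and a subsequence of the roots converges. The square of its limit has the same values as
  \<open>f\<close>.\<close>

lemma square_limit:
  fixes f :: "'n::finite mpoly"
  assumes "\<And>k. \<exists>h\<in>forms d. F k = h\<^sup>2" "f \<in> forms (2 * d)" "coeff_lim F f"
  shows "\<exists>h\<in>forms d. f = h\<^sup>2"
proof -
  obtain H where H: "\<And>k. H k \<in> forms d" "\<And>k. F k = (H k)\<^sup>2" using assms(1) by metis
  have F: "F k \<in> forms (2 * d)" for k using H by (simp add: forms_square)
  obtain B where B: "\<And>k p. p \<in> UNIV \<rightarrow>\<^sub>E {..d} \<Longrightarrow> \<bar>eval_mpoly (F k) (grid_point p)\<bar> \<le> B"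
    using coeff_lim_grid_bounded[OF F assms(2,3), of d] by blast
  from forms_coefficient_bound[where 'n = 'n, of d] obtain C where
    C: "\<forall>h \<in> forms d. \<forall>B \<alpha>. (\<forall>p\<in>UNIV \<rightarrow>\<^sub>E {..d}. \<bar>eval_mpoly h (grid_point p)\<bar> \<le> B) \<longrightarrow>
      \<bar>Poly_Mapping.lookup (h :: 'n mpoly) \<alpha>\<bar> \<le> C * B" by (rule exE)
  have "\<bar>eval_mpoly (H k) (grid_point p)\<bar> \<le> sqrt B" if "p \<in> UNIV \<rightarrow>\<^sub>E {..d}" for k p
    using B[OF that, of k] by (auto simp: H(2) eval_square intro: real_le_rsqrt)
  then have "\<bar>Poly_Mapping.lookup (H k) \<alpha>\<bar> \<le> C * sqrt B" for k \<alpha>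
    using bspec[OF C H(1)] by blast
  then obtain r h where rh: "strict_mono r" "h \<in> forms d" "coeff_lim (\<lambda>k. H (r k)) h"
    using forms_common_subseq[of "{()}" "\<lambda>_. H" d "C * sqrt B"] H(1) by auto
  have "eval_mpoly f x = eval_mpoly (h\<^sup>2) x" for x
  proof (rule LIMSEQ_unique)
    show "(\<lambda>k. eval_mpoly (F (r k)) x) \<longlonglongrightarrow> eval_mpoly f x"
      by (rule coeff_lim_eval[OF F assms(2) coeff_lim_subseq[OF assms(3) rh(1)]])
    show "(\<lambda>k. eval_mpoly (F (r k)) x) \<longlonglongrightarrow> eval_mpoly (h\<^sup>2) x"
      unfolding H(2) eval_square by (intro tendsto_intros coeff_lim_eval[OF H(1) rh(2,3)])
  qed
  then have "f = h\<^sup>2" by (rule forms_eqI[OF assms(2) forms_square[OF rh(2)]])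
  then show ?thesis using rh(2) by blast
qed

section \<open>Limits of nonnegative circuits\<close>

text \<open>A positive term with even exponent is the square of the monomial with halved exponent
  and coefficient the square root.\<close>

lemma monomial_squares_in_SOS_SONC:
  assumes "f \<in> forms (2 * d)"
    and "\<And>\<alpha>. \<alpha> \<in> Poly_Mapping.keys f \<Longrightarrow> (\<forall>i. even (\<alpha> $ i)) \<and> Poly_Mapping.lookup f \<alpha> > 0"
  shows "f \<in> SOS_SONC d"
proof -
  have "Poly_Mapping.single \<alpha> (Poly_Mapping.lookup f \<alpha>) \<in> finite_sums (generators d)"
    if \<alpha>: "\<alpha> \<in> Poly_Mapping.keys f" for \<alpha>
  proof -
    define \<beta> where "\<beta> = (\<chi> i. \<alpha> $ i div 2)"
    have eq: "\<alpha> = \<beta> + \<beta>"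
      unfolding vec_eq_iff
    proof
      fix i
      have "even (\<alpha> $ i)" using assms(2)[OF \<alpha>] by blast
      then show "\<alpha> $ i = (\<beta> + \<beta>) $ i" by (simp add: \<beta>_def mult_2[symmetric])
    qed
    have "\<alpha> \<in> exps (2 * d)" using assms(1) \<alpha> by (auto simp: forms_eq)
    then have "\<beta> \<in> exps d" by (subst (asm) eq) (simp add: exps_def sum.distrib)
    moreover have "Poly_Mapping.single \<alpha> (Poly_Mapping.lookup f \<alpha>) =
        (Poly_Mapping.single \<beta> (sqrt (Poly_Mapping.lookup f \<alpha>)))\<^sup>2"
      using assms(2)[OF \<alpha>] by (simp add: power2_eq_square mult_single eq[symmetric])
    ultimately have "Poly_Mapping.single \<alpha> (Poly_Mapping.lookup f \<alpha>) \<in> generators d"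
      unfolding generators_def using forms_single by blast
    then show ?thesis by (rule finite_sums_incl)
  qed
  then have "(\<Sum>\<alpha>\<in>Poly_Mapping.keys f. Poly_Mapping.single \<alpha> (Poly_Mapping.lookup f \<alpha>)) \<in> SOS_SONC d"
    unfolding SOS_SONC_eq by (rule finite_sums_sum)
  then show ?thesis
    using poly_mapping_eq_sum_single[of "Poly_Mapping.keys f" f] by simp
qed

text \<open>Along this curve \<open>s\<close> fixes the sign of a monomial, while the exponential
  factor depends on \<alpha> only through a linear functional; a separating hyperplane can therefore
  select the dominant term.\<close>

lemma mono_eval_exp_scaled:
  "mono_eval \<alpha> (\<chi> i. s $ i * exp (- (t * a $ i))) =
     mono_eval \<alpha> s * exp (- (t * (a \<bullet> real_exponent \<alpha>)))"
proof -
  have "- (t * (a \<bullet> real_exponent \<alpha>)) = (\<Sum>i\<in>UNIV. real (\<alpha> $ i) * (- (t * a $ i)))"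
    by (simp add: inner_vec_def real_exponent_def sum_distrib_left sum_negf mult_ac)
  then have "exp (- (t * (a \<bullet> real_exponent \<alpha>))) = (\<Prod>i\<in>UNIV. exp (- (t * a $ i)) ^ (\<alpha> $ i))"
    by (simp only: exp_sum[OF finite] exp_of_nat_mult)
  then show ?thesis by (simp add: mono_eval_def power_mult_distrib prod.distrib)
qed

text \<open>A negative coefficient is seen at the all-ones point; for a positive one, some entry of
  the exponent is odd, and flipping the sign of that coordinate suffices.\<close>

lemma exists_negative_sign:
  fixes \<beta> :: "nat ^ 'n::finite"
  assumes "c \<noteq> 0" "\<not> ((\<forall>i. even (\<beta> $ i)) \<and> c > 0)"
  shows "\<exists>s. c * mono_eval \<beta> s < (0::real)"
proof (cases "c > 0")
  case True
  then obtain j where j: "odd (\<beta> $ j)" using assms by auto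
  let ?s = "(\<chi> i. if i = j then - 1 else 1) :: real ^ 'n"
  have "mono_eval \<beta> ?s = (\<Prod>i\<in>UNIV. if i = j then - 1 else 1)"
    unfolding mono_eval_def using j by (intro prod.cong) auto
  then have "c * mono_eval \<beta> ?s < 0" using True by simp
  then show ?thesis by blast
next
  case False
  then have "c * mono_eval \<beta> (\<chi> i. 1) < 0" using assms(1) by (simp add: mono_eval_def)
  then show ?thesis by blast
qed

text \<open>
  A term outside the Newton polytope of the remaining terms dominates along a curve
  \<open>t \<mapsto> (s\<^sub>i exp (- t a\<^sub>i))\<close> whose direction \<open>a\<close> comes from a separating hyperplane.
\<close>

lemma eval_negative_if_exposed:
  assumes "\<beta> \<in> Poly_Mapping.keys f"
    and "\<not> ((\<forall>i. even (\<beta> $ i)) \<and> Poly_Mapping.lookup f \<beta> > 0)"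
    and "real_exponent \<beta> \<notin> convex hull (real_exponent ` (Poly_Mapping.keys f - {\<beta>}))"
  shows "\<exists>x. eval_mpoly f x < 0"
proof -
  let ?K = "Poly_Mapping.keys f" and ?c = "Poly_Mapping.lookup f"
  obtain s where s: "?c \<beta> * mono_eval \<beta> s < 0"
    using exists_negative_sign assms(1,2) by (metis in_keys_iff)
  have "closed (convex hull (real_exponent ` (?K - {\<beta>})))"
    by (intro compact_imp_closed finite_imp_compact_convex_hull) auto
  then obtain a b where ab: "a \<bullet> real_exponent \<beta> < b"
    "\<And>y. y \<in> convex hull (real_exponent ` (?K - {\<beta>})) \<Longrightarrow> a \<bullet> y > b"
    using separating_hyperplane_closed_point[OF convex_convex_hull _ assms(3)] by blast
  define e where "e \<alpha> = a \<bullet> real_exponent \<alpha> - a \<bullet> real_exponent \<beta>" for \<alpha>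
  have e: "e \<alpha> > 0" if "\<alpha> \<in> ?K - {\<beta>}" for \<alpha>
    using ab(1) ab(2)[of "real_exponent \<alpha>"] that by (force simp: e_def intro: hull_inc)
  define x where "x t = (\<chi> i. s $ i * exp (- (t * a $ i)))" for t
  \<comment> \<open>The positive factor makes the term of \<beta> constant in \<open>t\<close>, and
    every other term decays because \<open>e \<alpha>\<close> is positive.\<close>
  have eval_x: "eval_mpoly f (x t) * exp (t * (a \<bullet> real_exponent \<beta>)) =
      ?c \<beta> * mono_eval \<beta> s + (\<Sum>\<alpha>\<in>?K - {\<beta>}. ?c \<alpha> * mono_eval \<alpha> s * exp (- (t * e \<alpha>)))" for t
  proof -
    have "eval_mpoly f (x t) * exp (t * (a \<bullet> real_exponent \<beta>)) =
        (\<Sum>\<alpha>\<in>?K. ?c \<alpha> * mono_eval \<alpha> s * exp (- (t * e \<alpha>)))"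
      unfolding eval_mpoly_superset[OF finite_keys order.refl] x_def mono_eval_exp_scaled
        sum_distrib_right e_def
      by (intro sum.cong refl) (simp add: mult.assoc exp_add[symmetric] algebra_simps)
    then show ?thesis using assms(1) by (simp add: sum.remove[of ?K \<beta>] e_def)
  qed
  have "((\<lambda>t. exp (- (t * e \<alpha>))) \<longlongrightarrow> 0) at_top" if "\<alpha> \<in> ?K - {\<beta>}" for \<alpha>
    using e[OF that]
    by (intro filterlim_compose[OF exp_at_bot] filterlim_compose[OF filterlim_uminus_at_bot_at_top]
        filterlim_at_top_mult_tendsto_pos[OF tendsto_const _ filterlim_ident]) auto
  then have "((\<lambda>t. eval_mpoly f (x t) * exp (t * (a \<bullet> real_exponent \<beta>))) \<longlongrightarrow>
      ?c \<beta> * mono_eval \<beta> s + (\<Sum>\<alpha>\<in>?K - {\<beta>}. ?c \<alpha> * mono_eval \<alpha> s * 0)) at_top"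
    unfolding eval_x by (intro tendsto_intros)
  then have "\<forall>\<^sub>F t in at_top. eval_mpoly f (x t) * exp (t * (a \<bullet> real_exponent \<beta>)) < 0"
    using s by (intro order_tendstoD(2)) auto
  then obtain t where "eval_mpoly f (x t) * exp (t * (a \<bullet> real_exponent \<beta>)) < 0"
    using eventually_happens by fastforce
  then have "eval_mpoly f (x t) < 0" by (simp add: mult_less_0_iff)
  then show ?thesis by blast
qed

lemma inj_real_exponent: "inj real_exponent"
  by (auto simp: inj_def real_exponent_def vec_eq_iff)

text \<open>The Newton polytope is a simplex, so the vertices other than \<alpha> span a proper
  face, and proper faces miss the relative interior, where \<beta> lies.\<close>

lemma circuit_inner_not_in_facet:
  assumes "circuit d f" "inner_supp f = {\<beta>}" "\<alpha> \<in> even_pos_supp f"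
  shows "real_exponent \<beta> \<notin> convex hull (real_exponent ` (even_pos_supp f - {\<alpha>}))"
proof -
  let ?V = "vertices f"
  have V: "real_exponent ` even_pos_supp f = ?V" "\<not> affine_dependent ?V"
    "real_exponent \<beta> \<in> rel_interior (New f)"
    using assms by (auto simp: circuit_def)
  have New: "New f = convex hull ?V"
    unfolding vertices_def New_def by (rule Krein_Milman_polytope) auto
  have \<alpha>: "real_exponent \<alpha> \<in> ?V" using assms(3) V(1) by blast
  have "convex hull (?V - {real_exponent \<alpha>}) face_of New f"
    unfolding New face_of_convex_hull_affine_independent[OF V(2)] by blast
  moreover have "convex hull (?V - {real_exponent \<alpha>}) \<noteq> New f"
  \<comment> \<open>Otherwise the deleted vertex would lie in the affine hull of the others, against
    affine independence.\<close>
  proof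
    assume "convex hull (?V - {real_exponent \<alpha>}) = New f"
    then have "real_exponent \<alpha> \<in> convex hull (?V - {real_exponent \<alpha>})"
      using \<alpha> by (simp add: New hull_inc)
    then show False
      using V(2) \<alpha> convex_hull_subset_affine_hull unfolding affine_dependent_def by blast
  qed
  ultimately have "real_exponent \<beta> \<notin> convex hull (?V - {real_exponent \<alpha>})"
    using face_of_disjoint_rel_interior V(3) by blast
  moreover have "real_exponent ` (even_pos_supp f - {\<alpha>}) = ?V - {real_exponent \<alpha>}"
    using image_set_diff[OF inj_real_exponent, of "even_pos_supp f" "{\<alpha>}"] V(1) by simp
  ultimately show ?thesis by simp
qed

text \<open>With the support and the set of positive even exponents held fixed, only the
  coefficients vary. Either the limit consists of monomial squares, or the inner term survives and
  nonnegativity forces every vertex term to survive with it.\<close>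

lemma circuit_limit:
  assumes F: "\<And>k. nonneg_circuit d (F k)"
    and keys: "\<And>k. Poly_Mapping.keys (F k) = A"
    and supp: "\<And>k. even_pos_supp (F k) = E"
    and f: "f \<in> forms (2 * d)" "coeff_lim F f"
  shows "f \<in> SOS_SONC d"
proof (cases "\<forall>\<alpha>\<in>Poly_Mapping.keys f. (\<forall>i. even (\<alpha> $ i)) \<and> Poly_Mapping.lookup f \<alpha> > 0")
  case True
  then show ?thesis using f(1) by (intro monomial_squares_in_SOS_SONC) auto
next
  case False
  then obtain \<beta> where \<beta>: "\<beta> \<in> Poly_Mapping.keys f"
    "\<not> ((\<forall>i. even (\<beta> $ i)) \<and> Poly_Mapping.lookup f \<beta> > 0)" by blast
  have circ: "circuit d (F k)" for k using F by (simp add: nonneg_circuit_def)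
  have lim: "(\<lambda>k. Poly_Mapping.lookup (F k) \<alpha>) \<longlonglongrightarrow> Poly_Mapping.lookup f \<alpha>" for \<alpha>
    using f(2) by (simp add: coeff_lim_def)
  have keys_f: "Poly_Mapping.keys f \<subseteq> A"
  proof
    fix \<alpha> assume "\<alpha> \<in> Poly_Mapping.keys f"
    moreover have "Poly_Mapping.lookup f \<alpha> = 0" if "\<alpha> \<notin> A"
    proof -
      have "Poly_Mapping.lookup (F k) \<alpha> = 0" for k using that keys[of k] by (auto simp: in_keys_iff)
      then show ?thesis using lim[of \<alpha>] by (simp add: LIMSEQ_const_iff)
    qed
    ultimately show "\<alpha> \<in> A" by (auto simp: in_keys_iff)
  qed
  have E_ge: "(\<forall>i. even (\<alpha> $ i)) \<and> Poly_Mapping.lookup f \<alpha> \<ge> 0" if "\<alpha> \<in> E" for \<alpha>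
  proof -
    have "(\<forall>i. even (\<alpha> $ i)) \<and> Poly_Mapping.lookup (F k) \<alpha> > 0" for k
      using that supp[of k] by (auto simp: even_pos_supp_def)
    then show ?thesis using lim[of \<alpha>] by (auto intro: LIMSEQ_le_const less_imp_le)
  qed
  \<comment> \<open>The exponent \<beta> survives in the limit but is no monomial square there, so
    it must be the inner exponent of every \<open>F k\<close>.\<close>
  have "\<beta> \<notin> E" using E_ge[of \<beta>] \<beta> by (auto simp: in_keys_iff less_le)
  then have "\<beta> \<in> inner_supp (F k)" for k
    using \<beta>(1) keys_f by (auto simp: inner_supp_def keys supp)
  moreover have "inner_supp (F k) = {} \<or> (\<exists>b. inner_supp (F k) = {b})" for k
    using circ[of k] by (auto simp: circuit_def)
  ultimately have inner: "inner_supp (F k) = {\<beta>}" for k by (metis empty_iff singletonD)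
  have A: "A = insert \<beta> E"
    using inner[of 0] supp[of 0] keys[of 0] by (auto simp: inner_supp_def even_pos_supp_def)
  have f_nonneg: "eval_mpoly f x \<ge> 0" for x
  proof (rule LIMSEQ_le_const)
    show "(\<lambda>k. eval_mpoly (F k) x) \<longlonglongrightarrow> eval_mpoly f x"
      using circ by (intro coeff_lim_eval[OF _ f]) (auto simp: circuit_def)
    show "\<exists>N. \<forall>n\<ge>N. 0 \<le> eval_mpoly (F n) x" using F by (auto simp: nonneg_circuit_def)
  qed
  have E_pos: "Poly_Mapping.lookup f \<alpha> > 0" if \<alpha>: "\<alpha> \<in> E" for \<alpha>
  proof (rule ccontr)
    assume "\<not> ?thesis"
    then have "Poly_Mapping.lookup f \<alpha> = 0" using E_ge[OF \<alpha>] by simp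
    \<comment> \<open>Without \<alpha> the other exponents lie in a facet whose hull misses \<beta>,
      so the term of \<beta> is exposed and \<open>f\<close> takes a negative value.\<close>
    then have "Poly_Mapping.keys f - {\<beta>} \<subseteq> E - {\<alpha>}"
      using keys_f A by (auto simp: in_keys_iff)
    then have "convex hull (real_exponent ` (Poly_Mapping.keys f - {\<beta>}))
        \<subseteq> convex hull (real_exponent ` (E - {\<alpha>}))"
      by (intro hull_mono image_mono)
    moreover have "real_exponent \<beta> \<notin> convex hull (real_exponent ` (E - {\<alpha>}))"
      using circuit_inner_not_in_facet[OF circ inner, of \<alpha>] \<alpha> supp by simp
    ultimately have "\<exists>x. eval_mpoly f x < 0"
      using \<beta> by (intro eval_negative_if_exposed) auto
    then show False using f_nonneg by (meson not_less)
  qed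
  have kf: "Poly_Mapping.keys f = Poly_Mapping.keys (F 0)"
  proof
    show "Poly_Mapping.keys (F 0) \<subseteq> Poly_Mapping.keys f"
    proof
      fix \<alpha> assume "\<alpha> \<in> Poly_Mapping.keys (F 0)"
      then have "\<alpha> = \<beta> \<or> \<alpha> \<in> E" unfolding keys A by simp
      then show "\<alpha> \<in> Poly_Mapping.keys f" using \<beta>(1) E_pos[of \<alpha>] by (auto simp: in_keys_iff)
    qed
  qed (simp add: keys keys_f)
  have "even_pos_supp f = E"
  proof
    show "E \<subseteq> even_pos_supp f"
      using E_pos E_ge unfolding even_pos_supp_def kf keys A by blast
    show "even_pos_supp f \<subseteq> E"
      using \<beta>(2) unfolding even_pos_supp_def kf keys A by blast
  qed
  then have "nonneg_circuit d f"
    using circ[of 0] circuit_cong[OF kf] f_nonneg supp by (simp add: nonneg_circuit_def)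
  then show ?thesis by (simp add: SOS_SONC_eq generators_def finite_sums_incl)
qed

section \<open>Closedness of the cone\<close>

lemma infinitely_often_subseq:
  fixes c :: "nat \<Rightarrow> 'b"
  assumes "finite (range c)"
  shows "\<exists>r::nat \<Rightarrow> nat. \<exists>b. strict_mono r \<and> (\<forall>k. c (r k) = b)"
proof -
  obtain k0 where "infinite {k \<in> UNIV. c k = c k0}"
    using pigeonhole_infinite[of "UNIV :: nat set" c] assms by auto
  then obtain r :: "nat \<Rightarrow> nat" where "strict_mono r" "\<forall>n. r n \<in> {k \<in> UNIV. c k = c k0}"
    using infinite_enumerate by blast
  then show ?thesis by (intro exI[of _ r] exI[of _ "c k0"]) auto
qed

text \<open>Only finitely many combinations of kind, support and positive even exponents occur, so a
  subsequence keeps them constant and consists entirely of nonnegative circuits or entirely of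
  squares.\<close>

lemma generator_limit:
  assumes G: "\<And>k. G k \<in> generators d" and h: "h \<in> forms (2 * d)" "coeff_lim G h"
  shows "h \<in> SOS_SONC d"
proof -
  let ?c = "\<lambda>k. (nonneg_circuit d (G k), Poly_Mapping.keys (G k), even_pos_supp (G k))"
  have "Poly_Mapping.keys (G k) \<subseteq> exps (2 * d)" "even_pos_supp (G k) \<subseteq> exps (2 * d)" for k
    using generators_forms[OF G[of k]] by (auto simp: forms_eq even_pos_supp_def)
  then have "range ?c \<subseteq> UNIV \<times> Pow (exps (2 * d)) \<times> Pow (exps (2 * d))" by auto
  then have fin: "finite (range ?c)" by (rule finite_subset) auto
  from infinitely_often_subseq[OF fin] obtain r :: "nat \<Rightarrow> nat" and b
    where r: "strict_mono r" "\<forall>k. ?c (r k) = b" by (elim exE conjE)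
  have lim: "coeff_lim (\<lambda>k. G (r k)) h" by (rule coeff_lim_subseq[OF h(2) r(1)])
  obtain nn A E where b: "b = (nn, A, E)" by (cases b)
  show ?thesis
  proof (cases nn)
    case True
    then show ?thesis using r(2) b lim h(1) by (intro circuit_limit[of d "\<lambda>k. G (r k)" A E]) auto
  next
    case False
    then have sq: "\<exists>q\<in>forms d. G (r k) = q\<^sup>2" for k
      using G[of "r k"] r(2) b by (auto simp: generators_def)
    have "\<exists>q\<in>forms d. h = q\<^sup>2" by (rule square_limit[of d "\<lambda>k. G (r k)", OF sq h(1) lim])
    then show ?thesis by (auto simp: SOS_SONC_eq generators_def intro!: finite_sums_incl)
  qed
qed

text \<open>The monomials of degree \<open>2 * d\<close> span all generators, so Caratheodory's
  theorem bounds the number of summands by their number; its coefficients are absorbed by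
  \<open>generators_scaleR\<close>.\<close>

lemma SOS_SONC_bounded_length:
  assumes "f \<in> SOS_SONC d"
  shows "\<exists>g. (\<forall>j<card (exps (2 * d) :: (nat ^ 'n) set). g j \<in> generators d) \<and>
    (f :: 'n::finite mpoly) = (\<Sum>j<card (exps (2 * d) :: (nat ^ 'n) set). g j)"
proof -
  let ?M = "exps (2 * d) :: (nat ^ 'n) set"
  let ?E = "(\<lambda>\<alpha>. Poly_Mapping.single \<alpha> (1::real)) ` ?M"
  obtain m :: nat and h where h: "f = (\<Sum>j<m. h j)" "\<forall>j<m. h j \<in> generators d"
    using assms by (auto simp: SOS_SONC_eq finite_sums_def)
  have span: "q \<in> span ?E" if "q \<in> forms (2 * d)" for q
  proof -
    have "Poly_Mapping.single \<alpha> (Poly_Mapping.lookup q \<alpha>) =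
        Poly_Mapping.lookup q \<alpha> *\<^sub>R Poly_Mapping.single \<alpha> 1" for \<alpha>
      by (rule poly_mapping_eqI) (simp add: lookup_single when_def)
    then have "q = (\<Sum>\<alpha>\<in>?M. Poly_Mapping.lookup q \<alpha> *\<^sub>R Poly_Mapping.single \<alpha> 1)"
      using poly_mapping_eq_sum_single[of ?M q] that by (simp add: forms_eq)
    also have "\<dots> \<in> span ?E" by (intro span_sum span_scale span_base) auto
    finally show ?thesis .
  qed
  have "\<exists>J t. J \<subseteq> {..<m} \<and> card J \<le> card ?E \<and> (\<forall>j\<in>J. t j \<ge> 0) \<and>
      (\<Sum>j<m. 1 *\<^sub>R h j) = (\<Sum>j\<in>J. t j *\<^sub>R h j)"
    using h(2) by (intro cone_caratheodory) (auto intro: span generators_forms)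
  then obtain J t where J: "J \<subseteq> {..<m}" "card J \<le> card ?E" "\<forall>j\<in>J. t j \<ge> 0"
    "f = (\<Sum>j\<in>J. t j *\<^sub>R h j)" by (auto simp: h(1))
  have "finite J" using J(1) finite_subset by blast
  then obtain b where b: "bij_betw b {0..<card J} J" using ex_bij_betw_nat_finite by blast
  \<comment> \<open>Padding with the generator 0 makes the number of summands the same for every
    \<open>f\<close>.\<close>
  define g where "g i = (if i < card J then t (b i) *\<^sub>R h (b i) else 0)" for i
  have bJ: "b i \<in> J" if "i < card J" for i using b that by (auto simp: bij_betw_def)
  have gen: "g i \<in> generators d" for i
    using J(1,3) h(2) bJ by (auto simp: g_def zero_in_generators intro!: generators_scaleR)
  have "card J \<le> card ?M" using J(2) card_image_le[of ?M] by (meson finite_exps order.trans)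
  then have "(\<Sum>i<card ?M. g i) = (\<Sum>i<card J. g i)"
    by (intro sum.mono_neutral_right) (auto simp: g_def)
  also have "\<dots> = (\<Sum>i\<in>{0..<card J}. t (b i) *\<^sub>R h (b i))"
    by (intro sum.cong) (auto simp: g_def)
  also have "\<dots> = f" unfolding J(4) by (rule sum.reindex_bij_betw[OF b])
  finally show ?thesis using gen by (intro exI[of _ g]) auto
qed

text \<open>A number of summands independent of \<open>k\<close> allows one subsequence along which
  all summands converge; the limit is then a sum of limits of generators.\<close>

lemma SOS_SONC_limit:
  fixes f :: "'n::finite mpoly"
  assumes F: "\<And>k. F k \<in> SOS_SONC d" and f: "f \<in> forms (2 * d)" "coeff_lim F f"
  shows "f \<in> SOS_SONC d"
proof -
  define N where "N = card (exps (2 * d) :: (nat ^ 'n) set)"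
  obtain G where G: "\<And>k j. j < N \<Longrightarrow> G k j \<in> generators d" "\<And>k. F k = (\<Sum>j<N. G k j)"
    using SOS_SONC_bounded_length[OF F] unfolding N_def by metis
  have FF: "F k \<in> forms (2 * d)" for k using SOS_SONC_forms_nonneg[OF F] by blast
  obtain B where B: "\<And>k p. p \<in> UNIV \<rightarrow>\<^sub>E {..2 * d} \<Longrightarrow> \<bar>eval_mpoly (F k) (grid_point p)\<bar> \<le> B"
    using coeff_lim_grid_bounded[OF FF f, of "2 * d"] by blast
  from forms_coefficient_bound[where 'n = 'n, of "2 * d"] obtain C where
    C: "\<forall>h \<in> forms (2 * d). \<forall>B \<alpha>. (\<forall>p\<in>UNIV \<rightarrow>\<^sub>E {..2 * d}. \<bar>eval_mpoly h (grid_point p)\<bar> \<le> B) \<longrightarrow>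
      \<bar>Poly_Mapping.lookup (h :: 'n mpoly) \<alpha>\<bar> \<le> C * B" by (rule exE)
  \<comment> \<open>All summands are nonnegative, so nothing cancels and each is at most the whole
    sum.\<close>
  have "\<bar>eval_mpoly (G k j) (grid_point p)\<bar> \<le> B"
    if "j < N" "p \<in> UNIV \<rightarrow>\<^sub>E {..2 * d}" for k j p
  proof -
    have "\<bar>eval_mpoly (G k j) (grid_point p)\<bar> \<le> (\<Sum>j<N. eval_mpoly (G k j) (grid_point p))"
      using that generators_nonneg[OF G(1)]
      by (auto intro!: member_le_sum)
    also have "\<dots> = eval_mpoly (F k) (grid_point p)" by (simp add: G(2) eval_sum)
    also have "\<dots> \<le> B" using B[OF that(2), of k] by (simp add: abs_le_iff)
    finally show ?thesis .
  qed
  then have "\<bar>Poly_Mapping.lookup (G k j) \<alpha>\<bar> \<le> C * B" if "j < N" for k j \<alpha>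
    using that bspec[OF C generators_forms[OF G(1)[OF that]]] by blast
  then obtain r h where rh: "strict_mono r"
    "\<And>j. j < N \<Longrightarrow> h j \<in> forms (2 * d) \<and> coeff_lim (\<lambda>k. G (r k) j) (h j)"
    using forms_common_subseq[of "{..<N}" "\<lambda>j k. G k j" "2 * d" "C * B"] generators_forms[OF G(1)]
    by (auto simp: Ball_def)
  have "coeff_lim (\<lambda>k. F (r k)) (\<Sum>j<N. h j)"
    unfolding coeff_lim_def G(2) lookup_sum
    using rh(2) by (auto simp: coeff_lim_def intro!: tendsto_sum)
  then have "f = (\<Sum>j<N. h j)" using coeff_lim_unique coeff_lim_subseq[OF f(2) rh(1)] by blast
  moreover have "h j \<in> finite_sums (generators d)" if "j < N" for j
    using generator_limit[of "\<lambda>k. G (r k) j" d "h j"] rh(2)[OF that] G(1)[OF that]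
    by (simp add: SOS_SONC_eq)
  ultimately show ?thesis unfolding SOS_SONC_eq by (auto intro: finite_sums_sum)
qed

lemma closedin_SOS_SONC: "closedin (form_topology (2 * d)) (SOS_SONC d :: 'n::finite mpoly set)"
proof -
  let ?K = "SOS_SONC d :: 'n mpoly set" and ?H = "forms (2 * d) :: 'n mpoly set"
  \<comment> \<open>The complement of the cone within the forms will be the preimage of this open
    set, once every form adherent to the cone is shown to belong to it.\<close>
  let ?U = "- closure (Poly_Mapping.lookup ` ?K)"
  have lim: "f \<in> ?K" if f: "f \<in> ?H" and cl: "Poly_Mapping.lookup f \<in> closure (Poly_Mapping.lookup ` ?K)" for f
  proof -
    obtain \<phi> where \<phi>: "\<forall>k. \<phi> k \<in> Poly_Mapping.lookup ` ?K" "\<phi> \<longlonglongrightarrow> Poly_Mapping.lookup f"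
      using cl unfolding closure_sequential by (elim exE conjE)
    from \<phi>(1) have "\<forall>k. \<exists>q. q \<in> ?K \<and> \<phi> k = Poly_Mapping.lookup q" by auto
    from choice[OF this] obtain F where F: "\<And>k. F k \<in> ?K" "\<And>k. \<phi> k = Poly_Mapping.lookup (F k)"
      by auto
    have "(\<lambda>k. Poly_Mapping.lookup (F k) \<alpha>) \<longlonglongrightarrow> Poly_Mapping.lookup f \<alpha>" for \<alpha>
    proof -
      \<comment> \<open>Taking one coefficient is continuous in the product topology, so convergence
        there gives convergence of every coefficient.\<close>
      have "isCont (\<lambda>\<psi> :: nat ^ 'n \<Rightarrow> real. \<psi> \<alpha>) (Poly_Mapping.lookup f)"
        by (rule bspec[OF continuous_on_eq_continuous_at[OF open_UNIV, THEN iffD1,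
              OF continuous_on_product_coordinates]]) simp
      from isCont_tendsto_compose[OF this \<phi>(2)] show ?thesis by (simp add: F(2))
    qed
    then have "coeff_lim F f" by (simp add: coeff_lim_def)
    then show ?thesis by (rule SOS_SONC_limit[of F, OF F(1) f])
  qed
  have "Poly_Mapping.lookup f \<in> closure (Poly_Mapping.lookup ` ?K)" if "f \<in> ?K" for f
    using closure_subset[of "Poly_Mapping.lookup ` ?K"] imageI[OF that] by (rule subsetD)
  then have "?H - ?K = Poly_Mapping.lookup -` ?U \<inter> ?H" using lim by blast
  moreover have "openin euclidean ?U" by auto
  ultimately have "openin (form_topology (2 * d)) (?H - ?K)"
    unfolding form_topology_def openin_pullback_topology by blast
  moreover have "topspace (form_topology (2 * d)) = ?H"
    by (simp add: form_topology_def topspace_pullback_topology)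
  moreover have "?K \<subseteq> ?H"
    by (rule subsetI) (erule SOS_SONC_forms_nonneg[THEN conjunct1])
  ultimately show ?thesis by (simp add: closedin_def)
qed

theorem theorem4p4:
  fixes K :: "'n::finite mpoly set" and d :: nat
  assumes "d \<ge> 1" and "K = SOS_SONC d"
  shows "convex_cone K \<and>
         closedin (form_topology (2 * d)) K \<and>
         form_topology (2 * d) interior_of K \<noteq> {} \<and>
         K \<inter> uminus ` K \<subseteq> {0}"
  unfolding assms(2)
  using convex_cone_SOS_SONC closedin_SOS_SONC interior_SOS_SONC SOS_SONC_pointed by blast

end
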